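(* For every integer $n\geqslant 1$, the type $D$ Eulerian polynomials satisfy $$ \begin{aligned} D_{n+2}(t)=\;&[n(1+5t)+4t]D_{n+1}(t)+4t(1-t)D_{n+1}'(t)\\ &+[(1-t)^2-n(1+3t)^2-4n(n-1)t(1+2t)]D_n(t)\\ &-[4nt(1-t)(1+3t)+4t(1-t)^2]D_n'(t)-4t^2(1-t)^2D_n''(t)\\ &+[2n(n-1)t(3+2t+3t^2)+4n(n-1)(n-2)t^2(1+t)]D_{n-1}(t)\\ &+[2nt(1-t)^2(3+t)+8n(n-1)t^2(1-t)(1+t)]D_{n-1}'(t)\\ &+4nt^2(1-t)^2(1+t)D_{n-1}''(t), \end{aligned} $$ where primes denote derivatives with respect to $t$.
   Context: $B_n$ is the group of signed permutations $\pi=\pi_1\pi_2\cdots\pi_n$ of $\{1,\dots,n\}$ (so $|\pi_1|\cdots|\pi_n|$ is a permutation of $1,\dots,n$), and $D_n\subset B_n$ is the subgroup (Coxeter group of type $D$) of those with an even number of negative entries. For $n\geqslant 2$, an index $i\in\{0,1,\dots,n-1\}$ is a ($D$-)descent of $\pi$ if $\pi_i>\pi_{i+1}$, where $\pi_0:=-\pi_2$; $d(\pi)$ is the number of descents. For $n\geqslant 2$ the Eulerian polynomial of type $D$ is $D_n(t)=\sum_{\pi\in D_n}t^{d(\pi)}$; by convention $D_0(t)=D_1(t)=1$. *)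

theory Defs
  imports Complex_Main "HOL-Library.FuncSet" "HOL-Computational_Algebra.Polynomial"
begin

text \<open>
  A signed permutation is its window \<open>\<pi> 1, \<dots>, \<pi> n\<close>, extended by \<^const>\<open>undefined\<close>
  outside \<open>{1..n}\<close> so that distinct functions are distinct signed permutations.
\<close>

definition signed_perms :: "nat \<Rightarrow> (nat \<Rightarrow> int) set" where
  "signed_perms n =
     {\<pi> \<in> extensional {1..n}. bij_betw (\<lambda>i. \<bar>\<pi> i\<bar>) {1..n} {1..int n}}"

definition even_signed_perms :: "nat \<Rightarrow> (nat \<Rightarrow> int) set" where
  "even_signed_perms n = {\<pi> \<in> signed_perms n. even (card {i \<in> {1..n}. \<pi> i < 0})}"

text \<open>The entry at position \<open>0\<close> is \<open>- \<pi> 2\<close>; meaningful for \<open>n \<ge> 2\<close> only.\<close>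

definition entry_D :: "(nat \<Rightarrow> int) \<Rightarrow> nat \<Rightarrow> int" where
  "entry_D \<pi> i = (if i = 0 then - \<pi> 2 else \<pi> i)"

definition descents_D :: "nat \<Rightarrow> (nat \<Rightarrow> int) \<Rightarrow> nat set" where
  "descents_D n \<pi> = {i \<in> {0..<n}. entry_D \<pi> i > entry_D \<pi> (i + 1)}"

abbreviation tvar :: "int poly" ("\<t>") where
  "\<t> \<equiv> [:0, 1:]"

definition eulerian_D :: "nat \<Rightarrow> int poly" where
  "eulerian_D n =
     (if n < 2 then 1 else \<Sum>\<pi>\<in>even_signed_perms n. \<t> ^ card (descents_D n \<pi>))"

end

theory Submission
  imports Defs
begin

text \<open>
  The recurrence is a consequence of the relation
  \<open>D_n = B_n - n 2 ^ (n - 1) t A_(n - 1)\<close>,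
  where \<open>B_n\<close> is the Eulerian polynomial of type \<open>B\<close> and \<open>A_n\<close> that of type \<open>A\<close>, normalised to
  have constant term 1 (\<open>eulerian_D_eq\<close>).

  The relation comes from pairing each signed permutation \<open>\<pi>\<close> that has an even number of negative
  entries with the one obtained by changing the sign of \<open>\<pi>\<^sub>1\<close>. Over the two members of such a pair,
  the type \<open>B\<close> descents contribute the \<open>D\<close>-descent monomial of \<open>\<pi>\<close> plus \<open>t\<close> times the descent
  monomial of \<open>\<pi>\<^sub>2 \<dots> \<pi>\<^sub>n\<close> (\<open>des_flip_pair\<close>). Given \<open>\<bar>\<pi>\<^sub>1\<bar>\<close>, for which there are \<open>n\<close> choices, the
  word \<open>\<pi>\<^sub>2 \<dots> \<pi>\<^sub>n\<close> runs over all signed arrangements of the other \<open>n - 1\<close> letters, so that the second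
  terms add up to \<open>n t\<close> times \<open>2 ^ (n - 1) A_(n - 1)\<close> (\<open>sum_even_words_tl\<close>).

  Both \<open>B_n\<close> and \<open>2 ^ n A_n\<close> satisfy a first-order recurrence \<open>P_(n + 1) = L_n P_n\<close> with a differential
  operator \<open>L_n\<close> in \<open>t\<close>, obtained by inserting a letter of largest absolute value, with either sign,
  into a shorter word (\<open>sum_des_B_signed_words\<close>, \<open>sum_des_signed_words\<close>). The right-hand side of
  the theorem is linear in \<open>(D_(n + 1), D_n, D_(n - 1))\<close>, and it reproduces each of the two
  sequences \<open>B_n\<close> and \<open>n 2 ^ (n - 1) t A_(n - 1)\<close> separately. For either sequence, rewriting
  everything through the Eulerian polynomial of lowest index and its derivatives leaves identities
  between polynomials in \<open>n\<close> and \<open>t\<close>, one for each derivative (\<open>D_rhs_eulerian_B\<close>, \<open>D_rhs_scaled_eulerian_A\<close>).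
\<close>

section \<open>Inserting an extreme letter into a word\<close>

fun des :: "int list \<Rightarrow> nat" where
  "des (x # y # w) = (if x > y then 1 else 0) + des (y # w)"
| "des w = 0"

text \<open>
  Words are taken over an arbitrary set of absolute values, because deleting the first letter of a
  signed permutation leaves a word whose absolute values have a gap.
\<close>

definition signed_words :: "int set \<Rightarrow> int list set" where
  "signed_words T = {w. distinct (map abs w) \<and> abs ` set w = T}"

definition insert_at :: "nat \<Rightarrow> int \<Rightarrow> int list \<Rightarrow> int list" where
  "insert_at i m w = take i w @ m # drop i w"

lemma insert_at_0 [simp]: "insert_at 0 m w = m # w"
  by (simp add: insert_at_def)

lemma insert_at_Suc [simp]: "insert_at (Suc i) m (y # w) = y # insert_at i m w"
  by (simp add: insert_at_def)

text \<open>
  A letter larger than all the others makes a descent with its right neighbour only. Put at the end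
  or into an existing descent, it leaves the number of descents unchanged; put into an ascent, it
  creates one more. The fixed first letter \<open>x\<close> is there for the induction, and \<open>x = 0\<close> gives the
  type \<open>B\<close> convention.
\<close>

lemma sum_insert_above:
  fixes t :: "'a :: comm_ring_1"
  assumes "x < m" "\<forall>y\<in>set w. y < m"
  shows "(\<Sum>i\<le>length w. t ^ des (x # insert_at i m w)) =
    (1 + of_nat (des (x # w))) * t ^ des (x # w)
    + (of_nat (length w) - of_nat (des (x # w))) * t ^ Suc (des (x # w))"
  using assms
proof (induction w arbitrary: x)
  case (Cons y w)
  have step: "(\<Sum>i\<le>length (y # w). t ^ des (x # insert_at i m (y # w))) =
    t ^ Suc (des (y # w))
    + t ^ (if x > y then 1 else 0) * (\<Sum>i\<le>length w. t ^ des (y # insert_at i m w))"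
    using Cons.prems
    by (simp add: sum.atMost_Suc_shift sum_distrib_left power_add del: sum.atMost_Suc)
  have IH: "(\<Sum>i\<le>length w. t ^ des (y # insert_at i m w)) =
    (1 + of_nat (des (y # w))) * t ^ des (y # w)
    + (of_nat (length w) - of_nat (des (y # w))) * t ^ Suc (des (y # w))"
    using Cons by simp
  show ?case
    unfolding step IH by (cases "x > y") (simp_all add: algebra_simps)
qed simp

text \<open>
  A letter smaller than all the others makes a descent with its left neighbour only, so the end of
  the word is now one of the places that create a descent.
\<close>

lemma sum_insert_below:
  fixes t :: "'a :: comm_ring_1"
  assumes "m < x" "\<forall>y\<in>set w. m < y"
  shows "(\<Sum>i\<le>length w. t ^ des (x # insert_at i m w)) =
    of_nat (des (x # w)) * t ^ des (x # w)
    + (1 + of_nat (length w) - of_nat (des (x # w))) * t ^ Suc (des (x # w))"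
  using assms
proof (induction w arbitrary: x)
  case (Cons y w)
  have step: "(\<Sum>i\<le>length (y # w). t ^ des (x # insert_at i m (y # w))) =
    t ^ Suc (des (y # w))
    + t ^ (if x > y then 1 else 0) * (\<Sum>i\<le>length w. t ^ des (y # insert_at i m w))"
    using Cons.prems
    by (simp add: sum.atMost_Suc_shift sum_distrib_left power_add del: sum.atMost_Suc)
  have IH: "(\<Sum>i\<le>length w. t ^ des (y # insert_at i m w)) =
    of_nat (des (y # w)) * t ^ des (y # w)
    + (1 + of_nat (length w) - of_nat (des (y # w))) * t ^ Suc (des (y # w))"
    using Cons by simp
  show ?case
    unfolding step IH by (cases "x > y") (simp_all add: algebra_simps)
qed simp

text \<open>
  Without a fixed first letter the front is one more place for the new letter. It is neutral for a
  small letter and creates a descent for a large one, which is the reverse of what happens at the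
  end: the two cases have the same distribution.
\<close>

lemma sum_insert_extreme:
  fixes t :: "'a :: comm_ring_1"
  assumes "(\<forall>y\<in>set w. y < m) \<or> (\<forall>y\<in>set w. m < y)"
  shows "(\<Sum>i\<le>length w. t ^ des (insert_at i m w)) =
    (1 + of_nat (des w)) * t ^ des w
    + (of_nat (length w) - of_nat (des w)) * t ^ Suc (des w)"
proof (cases w)
  case (Cons y v)
  have *: "(\<Sum>i\<le>length w. t ^ des (insert_at i m w)) =
    t ^ des (m # y # v) + (\<Sum>i\<le>length v. t ^ des (y # insert_at i m v))"
    by (simp add: Cons sum.atMost_Suc_shift del: sum.atMost_Suc)
  from assms show ?thesis
  proof
    assume "\<forall>y\<in>set w. y < m"
    then show ?thesis
      unfolding * using sum_insert_above[of y m v t] by (simp add: Cons algebra_simps)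
  next
    assume "\<forall>y\<in>set w. m < y"
    then show ?thesis
      unfolding * using sum_insert_below[of m y v t] by (simp add: Cons algebra_simps)
  qed
qed simp

section \<open>Recurrences over signed words\<close>

lemma length_signed_word: "w \<in> signed_words T \<Longrightarrow> length w = card T"
  unfolding signed_words_def
  by (metis (mono_tags, lifting) distinct_card image_set length_map mem_Collect_eq)

lemma finite_signed_words:
  assumes "finite T"
  shows "finite (signed_words T)"
proof (rule finite_subset)
  show "signed_words T \<subseteq> {w. set w \<subseteq> T \<union> uminus ` T \<and> length w = card T}"
  proof
    fix w assume w: "w \<in> signed_words T"
    have "x \<in> T \<union> uminus ` T" if "x \<in> set w" for x
    proof -
      have "\<bar>x\<bar> \<in> T" using w that by (auto simp: signed_words_def)
      then show ?thesis by (cases "x \<ge> 0") (auto simp: image_iff intro: bexI[of _ "-x"])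
    qed
    then show "w \<in> {w. set w \<subseteq> T \<union> uminus ` T \<and> length w = card T}"
      using length_signed_word[OF w] by auto
  qed
  show "finite {w. set w \<subseteq> T \<union> uminus ` T \<and> length w = card T}"
    using assms by (intro finite_lists_length_eq) auto
qed

lemma signed_words_empty [simp]: "signed_words {} = {[]}"
  by (auto simp: signed_words_def)

text \<open>
  Deleting the letter of absolute value \<open>m\<close> recovers the shorter word, and the place and the sign of
  that letter are the remaining data.
\<close>

lemma sum_signed_words_insert:
  fixes f :: "int list \<Rightarrow> 'a :: comm_monoid_add"
  assumes "finite T" "m \<notin> T" "m > 0"
  shows "(\<Sum>w\<in>signed_words (insert m T). f w) =
    (\<Sum>w\<in>signed_words T. (\<Sum>i\<le>length w. f (insert_at i m w)) + (\<Sum>i\<le>length w. f (insert_at i (- m) w)))"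
proof -
  let ?X = "SIGMA w:signed_words T. {..length w} \<times> {m, - m}"
  let ?h = "\<lambda>(w, i, e). insert_at i e w"
  have "bij_betw ?h ?X (signed_words (insert m T))"
    unfolding bij_betw_def
  proof
    show "inj_on ?h ?X"
    proof (rule inj_onI)
      fix p q assume "p \<in> ?X" "q \<in> ?X" and hpq: "?h p = ?h q"
      then obtain w i e w' i' e' where pq: "p = (w, i, e)" "q = (w', i', e')"
        and w: "w \<in> signed_words T" "w' \<in> signed_words T"
        and i: "i \<in> {..length w}" "i' \<in> {..length w'}"
        and e: "e \<in> {m, - m}" "e' \<in> {m, - m}"
        by auto
      have eq: "insert_at i e w = insert_at i' e' w'"
        using hpq pq by simp
      have abs_e: "\<bar>e\<bar> = m" "\<bar>e'\<bar> = m" using e assms by auto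
      have notin: "m \<notin> set (map abs u)" if "u \<in> signed_words T" for u
        using that assms by (auto simp: signed_words_def)
      have "map abs (take i w) @ m # map abs (drop i w)
          = map abs (take i' w') @ m # map abs (drop i' w')"
        using arg_cong[OF eq, of "map abs"] abs_e by (simp add: insert_at_def)
      moreover have "m \<notin> set (map abs (take i w))" "m \<notin> set (map abs (drop i w))"
        using notin[OF w(1)] in_set_takeD[of _ i w] in_set_dropD[of _ i w] by auto
      ultimately have "map abs (take i w) = map abs (take i' w')"
        by (simp add: append_Cons_eq_iff)
      then have "length (take i w) = length (take i' w')"
        by (metis length_map)
      then have "take i w = take i' w' \<and> e = e' \<and> drop i w = drop i' w'" "i = i'"
        using eq i by (auto simp: insert_at_def append_eq_append_conv)
      then show "p = q"
        unfolding pq by (metis append_take_drop_id)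
    qed
    show "?h ` ?X = signed_words (insert m T)"
    proof (intro subset_antisym subsetI)
      fix v assume "v \<in> ?h ` ?X"
      then obtain w i e where w: "w \<in> signed_words T" and e: "e = m \<or> e = - m"
        and v: "v = insert_at i e w" by auto
      have "set v = insert e (set w)" "mset (map abs v) = mset (map abs (e # w))"
        unfolding v insert_at_def
        by (metis Un_insert_right append_take_drop_id list.simps(15) set_append)
          (metis append_take_drop_id mset_append mset_map union_mset_add_mset_right mset.simps(2))
      moreover from this(2) have "distinct (map abs v) = distinct (map abs (e # w))"
        by (metis mset_eq_imp_distinct_iff)
      ultimately show "v \<in> signed_words (insert m T)"
        using w e assms by (auto simp: signed_words_def)
    next
      fix v assume v: "v \<in> signed_words (insert m T)"
      then have "m \<in> abs ` set v" by (auto simp: signed_words_def)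
      then obtain e where "e \<in> set v" and abs_e: "m = \<bar>e\<bar>" by auto
      then obtain xs ys where split: "v = xs @ e # ys" by (meson split_list)
      have "distinct (map abs (xs @ ys))" "insert m (abs ` set (xs @ ys)) = insert m T"
        "m \<notin> abs ` set (xs @ ys)"
        using v abs_e unfolding signed_words_def split by auto
      then have "xs @ ys \<in> signed_words T"
        using assms(2) unfolding signed_words_def by (metis (mono_tags) insert_ident mem_Collect_eq)
      moreover have "e \<in> {m, - m}" using abs_e by auto
      ultimately show "v \<in> ?h ` ?X"
        by (intro image_eqI[of _ _ "(xs @ ys, length xs, e)"]) (auto simp: split insert_at_def)
    qed
  qed
  then have "(\<Sum>w\<in>signed_words (insert m T). f w) = (\<Sum>p\<in>?X. f (?h p))"
    by (simp add: sum.reindex_bij_betw)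
  also have "\<dots> = (\<Sum>w\<in>signed_words T. \<Sum>(i, e)\<in>{..length w} \<times> {m, - m}. f (insert_at i e w))"
    using finite_signed_words[OF assms(1)] by (subst sum.Sigma) (auto simp: split_def)
  also have "\<dots> = (\<Sum>w\<in>signed_words T.
      \<Sum>i\<le>length w. \<Sum>e\<in>{m, - m}. f (insert_at i e w))"
    by (simp add: sum.cartesian_product)
  also have "\<dots> = (\<Sum>w\<in>signed_words T. (\<Sum>i\<le>length w. f (insert_at i m w)) + (\<Sum>i\<le>length w. f (insert_at i (- m) w)))"
    using assms(3) by (simp add: sum.distrib)
  finally show ?thesis .
qed

primrec eulerian_B :: "nat \<Rightarrow> int poly" where
  "eulerian_B 0 = 1"
| "eulerian_B (Suc n) =
    (1 + (2 * of_nat n + 1) * \<t>) * eulerian_B n + 2 * \<t> * (1 - \<t>) * pderiv (eulerian_B n)"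

text \<open>
  This is \<open>2 ^ n\<close> times the type \<open>A\<close> Eulerian polynomial: each of the \<open>2 ^ n\<close> choices of signs for
  \<open>n\<close> given absolute values yields a set of \<open>n\<close> distinct letters, and the distribution of descents
  over the arrangements of such a set depends on \<open>n\<close> only.
\<close>

primrec scaled_eulerian_A :: "nat \<Rightarrow> int poly" where
  "scaled_eulerian_A 0 = 1"
| "scaled_eulerian_A (Suc n) =
    2 * ((1 + of_nat n * \<t>) * scaled_eulerian_A n + \<t> * (1 - \<t>) * pderiv (scaled_eulerian_A n))"

lemma tvar_pderiv_power: "\<t> * pderiv (\<t> ^ k) = of_nat k * \<t> ^ k"
proof (induction k)
  case (Suc k)
  have "pderiv \<t> = 1" by (simp add: pderiv_pCons)
  then have "\<t> * pderiv (\<t> ^ Suc k) = \<t> * (\<t> * pderiv (\<t> ^ k)) + \<t> ^ Suc k"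
    by (simp only: power_Suc pderiv_mult distrib_left mult_1_right)
  then show ?case
    unfolding Suc.IH by (simp only: power_Suc of_nat_Suc distrib_right mult_1_left mult_ac add_ac)
qed simp

lemma pderiv_sum: "pderiv (sum f A) = (\<Sum>x\<in>A. pderiv (f x))"
  using higher_pderiv_sum[of 1] by simp

text \<open>
  Weighting a monomial by its exponent is the operator \<open>t d/dt\<close>; this turns the counts of insertion
  places, which are linear in the number of descents, into a first-order differential operator.
\<close>

lemma sum_power_linear:
  fixes k :: "'b \<Rightarrow> nat" and b c :: "int poly"
  shows "(\<Sum>w\<in>W. (1 + c * of_nat (k w)) * \<t> ^ k w + (b - c * of_nat (k w)) * \<t> ^ Suc (k w)) =
    (1 + b * \<t>) * (\<Sum>w\<in>W. \<t> ^ k w) + c * \<t> * (1 - \<t>) * pderiv (\<Sum>w\<in>W. \<t> ^ k w)"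
proof -
  have *: "(1 + c * of_nat (k w)) * \<t> ^ k w + (b - c * of_nat (k w)) * \<t> ^ Suc (k w)
      = (1 + b * \<t>) * \<t> ^ k w + c * (1 - \<t>) * (\<t> * pderiv (\<t> ^ k w))" for w
    unfolding tvar_pderiv_power power_Suc by algebra
  show ?thesis
    unfolding * pderiv_sum sum.distrib by (simp only: sum_distrib_left mult_ac)
qed

lemma sum_des_signed_words:
  assumes "finite T" "\<forall>x\<in>T. x > 0"
  shows "(\<Sum>w\<in>signed_words T. \<t> ^ des w) = scaled_eulerian_A (card T)"
  using assms
proof (induction T rule: finite_linorder_max_induct)
  case (insert m T)
  have "m \<notin> T" "m > 0" using insert by auto
  then have "(\<Sum>w\<in>signed_words (insert m T). \<t> ^ des w) =
    (\<Sum>w\<in>signed_words T. (\<Sum>i\<le>length w. \<t> ^ des (insert_at i m w))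
       + (\<Sum>i\<le>length w. \<t> ^ des (insert_at i (- m) w)))"
    using insert by (intro sum_signed_words_insert) auto
  also have "\<dots> = (\<Sum>w\<in>signed_words T. 2 * ((1 + 1 * of_nat (des w)) * \<t> ^ des w
      + (of_nat (card T) - 1 * of_nat (des w)) * \<t> ^ Suc (des w)))"
  proof (rule sum.cong)
    fix w assume w: "w \<in> signed_words T"
    have bound: "\<bar>y\<bar> < m" if "y \<in> set w" for y
      using w that insert.hyps by (auto simp: signed_words_def)
    have "\<forall>y\<in>set w. y < m" "\<forall>y\<in>set w. - m < y"
      using bound by force+
    then show "(\<Sum>i\<le>length w. \<t> ^ des (insert_at i m w))
       + (\<Sum>i\<le>length w. \<t> ^ des (insert_at i (- m) w)) =
        2 * ((1 + 1 * of_nat (des w)) * \<t> ^ des w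
      + (of_nat (card T) - 1 * of_nat (des w)) * \<t> ^ Suc (des w))"
      unfolding length_signed_word[OF w, symmetric]
      by (subst (1 2) sum_insert_extreme) (blast, blast, algebra)
  qed simp
  also have "\<dots> = scaled_eulerian_A (Suc (card T))"
    unfolding sum_distrib_left[symmetric] sum_power_linear using insert by simp
  finally show ?case using insert \<open>m \<notin> T\<close> by simp
qed simp

lemma sum_des_B_signed_words:
  assumes "finite T" "\<forall>x\<in>T. x > 0"
  shows "(\<Sum>w\<in>signed_words T. \<t> ^ des (0 # w)) = eulerian_B (card T)"
  using assms
proof (induction T rule: finite_linorder_max_induct)
  case (insert m T)
  have "m \<notin> T" "m > 0" using insert by auto
  then have "(\<Sum>w\<in>signed_words (insert m T). \<t> ^ des (0 # w)) =
    (\<Sum>w\<in>signed_words T. (\<Sum>i\<le>length w. \<t> ^ des (0 # insert_at i m w))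
       + (\<Sum>i\<le>length w. \<t> ^ des (0 # insert_at i (- m) w)))"
    using insert by (intro sum_signed_words_insert) auto
  also have "\<dots> = (\<Sum>w\<in>signed_words T. (1 + 2 * of_nat (des (0 # w))) * \<t> ^ des (0 # w)
      + ((2 * of_nat (card T) + 1) - 2 * of_nat (des (0 # w))) * \<t> ^ Suc (des (0 # w)))"
  proof (rule sum.cong)
    fix w assume w: "w \<in> signed_words T"
    have bound: "\<bar>y\<bar> < m" if "y \<in> set w" for y
      using w that insert.hyps by (auto simp: signed_words_def)
    have "\<forall>y\<in>set w. y < m" "\<forall>y\<in>set w. - m < y"
      using bound by force+
    with \<open>m > 0\<close> have sums:
      "(\<Sum>i\<le>length w. \<t> ^ des (0 # insert_at i m w)) =
        (1 + of_nat (des (0 # w))) * \<t> ^ des (0 # w)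
        + (of_nat (card T) - of_nat (des (0 # w))) * \<t> ^ Suc (des (0 # w))"
      "(\<Sum>i\<le>length w. \<t> ^ des (0 # insert_at i (- m) w)) =
        of_nat (des (0 # w)) * \<t> ^ des (0 # w)
        + (1 + of_nat (card T) - of_nat (des (0 # w))) * \<t> ^ Suc (des (0 # w))"
      unfolding length_signed_word[OF w, symmetric]
      by (intro sum_insert_above sum_insert_below; simp)+
    show "(\<Sum>i\<le>length w. \<t> ^ des (0 # insert_at i m w))
       + (\<Sum>i\<le>length w. \<t> ^ des (0 # insert_at i (- m) w)) =
       (1 + 2 * of_nat (des (0 # w))) * \<t> ^ des (0 # w)
      + ((2 * of_nat (card T) + 1) - 2 * of_nat (des (0 # w))) * \<t> ^ Suc (des (0 # w))"
      unfolding sums power_Suc by algebra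
  qed simp
  also have "\<dots> = eulerian_B (Suc (card T))"
    unfolding sum_power_linear using insert by simp
  finally show ?case using insert \<open>m \<notin> T\<close> by simp
qed simp

section \<open>Signed permutations as words\<close>

lemma des_map_upt:
  "a \<le> b \<Longrightarrow> des (map f [a..<Suc b]) = card {i \<in> {a..<b}. f i > f (Suc i)}"
proof (induction a rule: inc_induct)
  case (step a)
  let ?S = "\<lambda>a. {i \<in> {a..<b}. f i > f (Suc i)}"
  have "[a..<Suc b] = a # Suc a # [Suc (Suc a)..<Suc b]" "[Suc a..<Suc b] = Suc a # [Suc (Suc a)..<Suc b]"
    using step.hyps by (simp_all add: upt_conv_Cons)
  moreover have "?S a = (if f a > f (Suc a) then insert a (?S (Suc a)) else ?S (Suc a))"
    using step.hyps by (auto simp: Suc_le_eq) (metis le_eq_less_or_eq not_less_eq_eq)+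
  moreover have "a \<notin> ?S (Suc a)" "finite (?S (Suc a))" by auto
  ultimately show ?case
    using step.IH by simp
qed simp

lemma window_in_signed_words_iff:
  assumes "\<pi> \<in> extensional {1..n}"
  shows "map \<pi> [1..<Suc n] \<in> signed_words {1..int n} \<longleftrightarrow> \<pi> \<in> signed_perms n"
proof -
  have "map abs (map \<pi> [1..<Suc n]) = map (\<lambda>i. \<bar>\<pi> i\<bar>) [1..<Suc n]"
    "abs ` set (map \<pi> [1..<Suc n]) = (\<lambda>i. \<bar>\<pi> i\<bar>) ` {1..n}"
    by (auto simp del: upt_Suc)
  moreover have "set [1..<Suc n] = {1..n}" by auto
  ultimately show ?thesis
    unfolding signed_words_def signed_perms_def bij_betw_def mem_Collect_eq
    using assms by (simp only: distinct_map distinct_upt simp_thms)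
qed

lemma bij_betw_window:
  "bij_betw (\<lambda>\<pi>. map \<pi> [1..<Suc n]) (signed_perms n) (signed_words {1..int n})"
  unfolding bij_betw_def
proof
  show "inj_on (\<lambda>\<pi>. map \<pi> [1..<Suc n]) (signed_perms n)"
  proof (rule inj_onI)
    fix \<pi> \<sigma>
    assume "\<pi> \<in> signed_perms n" "\<sigma> \<in> signed_perms n"
      and eq: "map \<pi> [1..<Suc n] = map \<sigma> [1..<Suc n]"
    then have "\<pi> \<in> extensional {1..n}" "\<sigma> \<in> extensional {1..n}"
      by (auto simp: signed_perms_def)
    then show "\<pi> = \<sigma>"
      using eq by (intro extensionalityI) (auto simp del: upt_Suc)
  qed
  show "(\<lambda>\<pi>. map \<pi> [1..<Suc n]) ` signed_perms n = signed_words {1..int n}"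
  proof (intro subset_antisym subsetI)
    fix w assume w: "w \<in> signed_words {1..int n}"
    define \<pi> where "\<pi> = (\<lambda>i\<in>{1..n}. w ! (i - 1))"
    have "map \<pi> [1..<Suc n] = w"
      using length_signed_word[OF w]
      by (intro nth_equalityI) (auto simp: \<pi>_def simp del: upt_Suc)
    moreover from this have "\<pi> \<in> signed_perms n"
      using w window_in_signed_words_iff[of \<pi> n] by (simp add: \<pi>_def)
    ultimately show "w \<in> (\<lambda>\<pi>. map \<pi> [1..<Suc n]) ` signed_perms n"
      by blast
  next
    fix w assume "w \<in> (\<lambda>\<pi>. map \<pi> [1..<Suc n]) ` signed_perms n"
    then obtain \<pi> where "\<pi> \<in> signed_perms n" "w = map \<pi> [1..<Suc n]" by blast
    then show "w \<in> signed_words {1..int n}"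
      using window_in_signed_words_iff[of \<pi> n] by (simp add: signed_perms_def del: upt_Suc)
  qed
qed

definition neg_count :: "int list \<Rightarrow> nat" where
  "neg_count w = length (filter (\<lambda>x. x < 0) w)"

definition even_words :: "int set \<Rightarrow> int list set" where
  "even_words T = {w \<in> signed_words T. even (neg_count w)}"

lemma neg_count_Cons [simp]: "neg_count (x # w) = (if x < 0 then 1 else 0) + neg_count w"
  by (simp add: neg_count_def)

text \<open>
  The \<open>D\<close>-descents of \<open>\<pi>\<close> are the ordinary descents of its window preceded by \<open>- \<pi> 2\<close>, which is
  the letter of index 1 in the window.
\<close>

lemma eulerian_D_words:
  assumes "n \<ge> 2"
  shows "eulerian_D n = (\<Sum>w\<in>even_words {1..int n}. \<t> ^ des (- (w ! 1) # w))"
proof -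
  let ?win = "\<lambda>\<pi>. map \<pi> [1..<Suc n]"
  have neg: "neg_count (?win \<pi>) = card {i \<in> {1..n}. \<pi> i < 0}" for \<pi> :: "nat \<Rightarrow> int"
  proof -
    have "neg_count (?win \<pi>) = card (set (filter (\<lambda>i. \<pi> i < 0) [1..<Suc n]))"
      by (subst distinct_card) (simp_all add: neg_count_def filter_map comp_def del: upt_Suc)
    also have "set (filter (\<lambda>i. \<pi> i < 0) [1..<Suc n]) = {i \<in> {1..n}. \<pi> i < 0}"
      by auto
    finally show ?thesis .
  qed
  have des: "card (descents_D n \<pi>) = des (- (?win \<pi> ! 1) # ?win \<pi>)" for \<pi>
  proof -
    have "map (entry_D \<pi>) [0..<Suc n] = - (?win \<pi> ! 1) # ?win \<pi>"
      using assms by (simp add: upt_conv_Cons entry_D_def numeral_2_eq_2 del: upt_Suc)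
    then show ?thesis
      unfolding descents_D_def using des_map_upt[of 0 n "entry_D \<pi>"] by simp
  qed
  have "bij_betw ?win (even_signed_perms n) (even_words {1..int n})"
  proof (rule bij_betw_subset[OF bij_betw_window])
    have "even_words {1..int n} = {w \<in> ?win ` signed_perms n. even (neg_count w)}"
      using bij_betw_window[of n] by (simp add: even_words_def bij_betw_def)
    moreover have "even_signed_perms n = {\<pi> \<in> signed_perms n. even (neg_count (?win \<pi>))}"
      by (simp only: even_signed_perms_def neg)
    ultimately show "?win ` even_signed_perms n = even_words {1..int n}"
      by (simp only: Compr_image_eq)
  qed (auto simp: even_signed_perms_def)
  then show ?thesis
    using assms by (simp add: eulerian_D_def des sum.reindex_bij_betw[symmetric] del: upt_Suc)
qed

section \<open>The relation between types A, B and D\<close>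

fun flip_hd :: "int list \<Rightarrow> int list" where
  "flip_hd (x # w) = - x # w"
| "flip_hd [] = []"

lemma flip_hd_flip_hd [simp]: "flip_hd (flip_hd w) = w"
  by (cases w) auto

lemma flip_hd_signed_word: "w \<in> signed_words T \<Longrightarrow> flip_hd w \<in> signed_words T"
  by (cases w) (auto simp: signed_words_def)

lemma even_neg_count_flip_hd:
  assumes "w \<in> signed_words T" "0 \<notin> T" "T \<noteq> {}"
  shows "even (neg_count (flip_hd w)) \<longleftrightarrow> odd (neg_count w)"
  using assms by (cases w) (auto simp: signed_words_def)

lemma sum_signed_words_flip:
  fixes f :: "int list \<Rightarrow> 'a :: comm_monoid_add"
  assumes "finite T" "0 \<notin> T" "T \<noteq> {}"
  shows "(\<Sum>w\<in>signed_words T. f w) = (\<Sum>w\<in>even_words T. f w + f (flip_hd w))"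
proof -
  have split: "signed_words T = even_words T \<union> flip_hd ` even_words T"
  proof (intro subset_antisym subsetI)
    fix w assume w: "w \<in> signed_words T"
    show "w \<in> even_words T \<union> flip_hd ` even_words T"
    proof (cases "even (neg_count w)")
      case False
      then have "flip_hd w \<in> even_words T"
        using w assms by (simp add: even_words_def even_neg_count_flip_hd flip_hd_signed_word)
      then show ?thesis by (metis UnI2 flip_hd_flip_hd image_eqI)
    qed (use w in \<open>simp add: even_words_def\<close>)
  qed (auto simp: even_words_def flip_hd_signed_word)
  have disjoint: "even_words T \<inter> flip_hd ` even_words T = {}"
    using assms even_neg_count_flip_hd by (auto simp: even_words_def)
  have "finite (even_words T)"
    using finite_signed_words[OF assms(1)] by (simp add: even_words_def)
  moreover have "inj flip_hd" by (metis flip_hd_flip_hd injI)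
  ultimately show ?thesis
    unfolding split using disjoint
    by (simp add: sum.union_disjoint sum.distrib sum.reindex inj_on_subset)
qed

text \<open>
  The sign of the first letter is forced by parity, so an even word amounts to the absolute value of
  its first letter together with an arbitrary signed arrangement of the other absolute values.
\<close>

lemma sum_even_words_tl:
  fixes f :: "int list \<Rightarrow> 'a :: comm_monoid_add"
  assumes "finite T" "\<forall>x\<in>T. x > 0" "T \<noteq> {}"
  shows "(\<Sum>w\<in>even_words T. f (tl w)) = (\<Sum>a\<in>T. \<Sum>v\<in>signed_words (T - {a}). f v)"
proof -
  define h where "h = (\<lambda>(a, v). (if even (neg_count v) then a else - a) # v)"
  have "(\<Sum>w\<in>even_words T. f (tl w)) =
    (\<Sum>(a, v)\<in>(SIGMA a:T. signed_words (T - {a})). f v)"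
  proof (rule sum.reindex_bij_witness[where i = h and j = "\<lambda>w. (\<bar>hd w\<bar>, tl w)"])
    fix w assume w: "w \<in> even_words T"
    then obtain x v where [simp]: "w = x # v"
      using assms by (cases w) (auto simp: even_words_def signed_words_def)
    have "\<bar>x\<bar> \<notin> abs ` set v" "insert \<bar>x\<bar> (abs ` set v) = T" "distinct (map abs v)"
      using w by (auto simp: even_words_def signed_words_def)
    then show "(\<bar>hd w\<bar>, tl w) \<in> (SIGMA a:T. signed_words (T - {a}))"
      by (auto simp: signed_words_def image_iff)
    have "x \<noteq> 0" "even (neg_count w)"
      using w assms by (auto simp: even_words_def signed_words_def)
    then show "h (\<bar>hd w\<bar>, tl w) = w"
      by (auto simp: h_def split: if_splits)
  next
    fix p assume "p \<in> (SIGMA a:T. signed_words (T - {a}))"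
    then obtain a v where [simp]: "p = (a, v)" and a: "a \<in> T" and v: "v \<in> signed_words (T - {a})"
      by auto
    have "a > 0" using a assms by auto
    then show "(\<bar>hd (h p)\<bar>, tl (h p)) = p"
      by (simp add: h_def)
    have "abs ` set v = T - {a}" using v by (simp add: signed_words_def)
    then show "h p \<in> even_words T"
      using a v \<open>a > 0\<close> by (auto simp: h_def even_words_def signed_words_def)
  qed auto
  also have "\<dots> = (\<Sum>a\<in>T. \<Sum>v\<in>signed_words (T - {a}). f v)"
    using assms finite_signed_words by (subst sum.Sigma) auto
  finally show ?thesis .
qed

text \<open>
  For \<open>\<bar>a\<bar> < b\<close>, \<open>\<bar>b\<bar> < \<bar>a\<bar>\<close> and \<open>b < - \<bar>a\<bar>\<close> the \<open>D\<close>-descents before \<open>b\<close> number 0, 1 and 2, whatever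
  the sign of \<open>a\<close>. The type \<open>B\<close> descents before \<open>b\<close> number \<open>{0, 1}\<close>, \<open>{1, 1}\<close> and \<open>{1, 2}\<close> over the
  two signs: in each case the \<open>D\<close>-value occurs, and the other value is 1.
\<close>

lemma des_flip_pair:
  fixes t :: "'a :: comm_semiring_1"
  assumes "a \<noteq> 0" "\<bar>a\<bar> \<noteq> \<bar>b\<bar>"
  shows "t ^ des (0 # a # b # v) + t ^ des (0 # - a # b # v) =
    t ^ des (- b # a # b # v) + t * t ^ des (b # v)"
  using assms by (auto simp: abs_if algebra_simps split: if_splits)

text \<open>
  The formula also agrees with the conventional values 1 for \<open>n = 0\<close>, where the factor \<open>n\<close> kills the
  correction term, and for \<open>n = 1\<close>, where it is \<open>(1 + t) - t\<close>.
\<close>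

lemma eulerian_D_eq:
  "eulerian_D n = eulerian_B n - of_nat n * \<t> * scaled_eulerian_A (n - 1)"
proof (cases "n < 2")
  case True
  then have "n = 0 \<or> n = 1" by auto
  then show ?thesis by (auto simp: eulerian_D_def)
next
  case False
  let ?T = "{1..int n}"
  have T: "finite ?T" "\<forall>x\<in>?T. x > 0" "?T \<noteq> {}" "0 \<notin> ?T" "card ?T = n"
    using False by auto
  have "eulerian_B n = (\<Sum>w\<in>even_words ?T. \<t> ^ des (0 # w) + \<t> ^ des (0 # flip_hd w))"
    using sum_signed_words_flip[OF T(1,4,3), of "\<lambda>w. \<t> ^ des (0 # w)"]
    unfolding sum_des_B_signed_words[OF T(1,2)] T(5) .
  also have "\<dots> = (\<Sum>w\<in>even_words ?T. \<t> ^ des (- (w ! 1) # w) + \<t> * \<t> ^ des (tl w))"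
  proof (rule sum.cong)
    fix w assume "w \<in> even_words ?T"
    then have w: "w \<in> signed_words ?T" by (simp add: even_words_def)
    then obtain a b v where [simp]: "w = a # b # v"
      using length_signed_word[OF w] False by (cases w; cases "tl w") auto
    have "\<bar>a\<bar> \<in> abs ` set w" by simp
    also have "abs ` set w = ?T" using w by (simp only: signed_words_def mem_Collect_eq)
    finally have "a \<noteq> 0" by auto
    moreover have "\<bar>a\<bar> \<noteq> \<bar>b\<bar>" using w by (simp add: signed_words_def)
    ultimately have "\<t> ^ des (0 # a # b # v) + \<t> ^ des (0 # - a # b # v) =
      \<t> ^ des (- b # a # b # v) + \<t> * \<t> ^ des (b # v)"
      by (rule des_flip_pair)
    then show "\<t> ^ des (0 # w) + \<t> ^ des (0 # flip_hd w) = \<t> ^ des (- (w ! 1) # w) + \<t> * \<t> ^ des (tl w)"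
      by (simp only: \<open>w = a # b # v\<close> flip_hd.simps list.sel nth_Cons_0 nth_Cons_Suc One_nat_def)
  qed simp
  also have "\<dots> = eulerian_D n + \<t> * (\<Sum>w\<in>even_words ?T. \<t> ^ des (tl w))"
    using False by (simp only: sum.distrib sum_distrib_left eulerian_D_words not_less)
  also have "(\<Sum>w\<in>even_words ?T. \<t> ^ des (tl w)) = (\<Sum>a\<in>?T. \<Sum>v\<in>signed_words (?T - {a}). \<t> ^ des v)"
    using T by (intro sum_even_words_tl) auto
  also have "\<dots> = (\<Sum>a\<in>?T. scaled_eulerian_A (n - 1))"
  proof (rule sum.cong)
    fix a assume "a \<in> ?T"
    then have "card (?T - {a}) = n - 1" using T by simp
    then show "(\<Sum>v\<in>signed_words (?T - {a}). \<t> ^ des v) = scaled_eulerian_A (n - 1)"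
      using sum_des_signed_words[of "?T - {a}"] by simp
  qed simp
  also have "\<dots> = of_nat n * scaled_eulerian_A (n - 1)" by simp
  finally show ?thesis by algebra
qed

section \<open>The differential recurrence\<close>

text \<open>
  The right-hand side of the recurrence as an operator on three arbitrary polynomials. The
  eliminations below use only \<open>dt/dt = 1\<close> and \<open>dn/dt = 0\<close>, so \<open>t\<close> and \<open>n\<close> enter as variables.
\<close>

definition D_rhs ::
  "int poly \<Rightarrow> int poly \<Rightarrow> int poly \<Rightarrow> int poly \<Rightarrow> int poly \<Rightarrow> int poly" where
  "D_rhs t N X Y Z =
      (N * (1 + 5 * t) + 4 * t) * X
    + 4 * t * (1 - t) * pderiv X
    + ((1 - t)^2 - N * (1 + 3 * t)^2 - 4 * N * (N - 1) * t * (1 + 2 * t)) * Y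
    - (4 * N * t * (1 - t) * (1 + 3 * t) + 4 * t * (1 - t)^2) * pderiv Y
    - 4 * t^2 * (1 - t)^2 * pderiv (pderiv Y)
    + (2 * N * (N - 1) * t * (3 + 2 * t + 3 * t^2)
        + 4 * N * (N - 1) * (N - 2) * t^2 * (1 + t)) * Z
    + (2 * N * t * (1 - t)^2 * (3 + t) + 8 * N * (N - 1) * t^2 * (1 - t) * (1 + t)) * pderiv Z
    + 4 * N * t^2 * (1 - t)^2 * (1 + t) * pderiv (pderiv Z)"

lemma D_rhs_diff:
  "D_rhs t N (X - X') (Y - Y') (Z - Z') = D_rhs t N X Y Z - D_rhs t N X' Y' Z'"
  unfolding D_rhs_def pderiv_diff by algebra

lemmas pderiv_rules = pderiv_add pderiv_diff pderiv_mult pderiv_numeral pderiv_1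
  mult_zero_right mult_zero_left add_0_left add_0_right diff_0_right mult_1_right

text \<open>
  The hypotheses on \<open>b1\<close>, \<open>b2\<close>, \<open>b3\<close> are three consecutive type \<open>B\<close> recurrences. The initial \<open>b0\<close>
  is arbitrary: after elimination of \<open>b1\<close>, \<open>b2\<close>, \<open>b3\<close> the coefficients of \<open>b0\<close> and of its
  derivatives agree on both sides, where \<open>N\<close> stands for the integer \<open>n\<close> as a constant polynomial.
\<close>

lemma D_rhs_eulerian_B:
  fixes t N b0 :: "int poly"
  assumes t: "pderiv t = 1" and N: "pderiv N = 0"
  assumes b1: "b1 = (1 + (2 * N - 1) * t) * b0 + 2 * t * (1 - t) * pderiv b0"
    and b2: "b2 = (1 + (2 * N + 1) * t) * b1 + 2 * t * (1 - t) * pderiv b1"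
    and b3: "b3 = (1 + (2 * N + 3) * t) * b2 + 2 * t * (1 - t) * pderiv b2"
  shows "b3 = D_rhs t N b2 b1 b0"
proof -
  \<comment> \<open>Each derivative is expressed through polynomials of the preceding index, from which \<open>b0\<close> and
    its derivatives are reached in two steps.\<close>
  define c d e where "c = pderiv b0" and "d = pderiv c" and "e = pderiv d"
  note fold = c_def[symmetric] d_def[symmetric] e_def[symmetric]
  define b1' where "b1' = pderiv b1"
  define b1'' where "b1'' = pderiv b1'"
  define b2' where "b2' = pderiv b2"
  have b1'_eq: "b1' = (2 * N - 1) * b0 + (3 + (2 * N - 5) * t) * c + 2 * t * (1 - t) * d"
    unfolding b1'_def b1 pderiv_rules t N fold by algebra
  have b1''_eq: "b1'' = (4 * N - 6) * c + (5 + (2 * N - 9) * t) * d + 2 * t * (1 - t) * e"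
    unfolding b1''_def b1'_eq pderiv_rules t N fold by algebra
  have b2'_eq: "b2' = (2 * N + 1) * b1 + (3 + (2 * N - 3) * t) * b1' + 2 * t * (1 - t) * b1''"
    unfolding b2'_def b2 pderiv_rules t N b1'_def[symmetric] b1''_def[symmetric] by algebra
  show ?thesis
    unfolding b3 D_rhs_def b2'_def[symmetric] b1'_def[symmetric] b1''_def[symmetric] fold
    unfolding b2'_eq b2 b1'_def[symmetric]
    unfolding b1''_eq b1'_eq b1 fold
    by algebra
qed

text \<open>
  The same elimination for the correction terms, with \<open>g0\<close> of index \<open>n - 2\<close>.
\<close>

lemma D_rhs_scaled_eulerian_A:
  fixes t N g0 :: "int poly"
  assumes t: "pderiv t = 1" and N: "pderiv N = 0"
  assumes g1: "g1 = 2 * ((1 + (N - 2) * t) * g0 + t * (1 - t) * pderiv g0)"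
    and g2: "g2 = 2 * ((1 + (N - 1) * t) * g1 + t * (1 - t) * pderiv g1)"
    and g3: "g3 = 2 * ((1 + N * t) * g2 + t * (1 - t) * pderiv g2)"
  shows "(N + 2) * t * g3 = D_rhs t N ((N + 1) * t * g2) (N * t * g1) ((N - 1) * t * g0)"
proof -
  define c d e where "c = pderiv g0" and "d = pderiv c" and "e = pderiv d"
  note fold = c_def[symmetric] d_def[symmetric] e_def[symmetric]
  define g1' where "g1' = pderiv g1"
  define g1'' where "g1'' = pderiv g1'"
  define g2' where "g2' = pderiv g2"
  note fold1 = g1'_def[symmetric] g1''_def[symmetric] g2'_def[symmetric]
  have g1'_eq: "g1' = 2 * ((N - 2) * g0 + (2 + (N - 4) * t) * c + t * (1 - t) * d)"
    unfolding g1'_def g1 pderiv_rules t N fold by algebra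
  have g1''_eq: "g1'' = 2 * ((2 * N - 6) * c + (3 + (N - 6) * t) * d + t * (1 - t) * e)"
    unfolding g1''_def g1'_eq pderiv_rules t N fold by algebra
  have g2'_eq: "g2' = 2 * ((N - 1) * g1 + (2 + (N - 3) * t) * g1' + t * (1 - t) * g1'')"
    unfolding g2'_def g2 pderiv_rules t N fold1 by algebra
  show ?thesis
    unfolding g3 D_rhs_def pderiv_rules t N fold fold1
    unfolding g2'_eq g2 fold1
    unfolding g1''_eq g1'_eq g1 fold
    by algebra
qed

text \<open>
  For \<open>n = 1\<close> there is no type \<open>A\<close> polynomial of index \<open>n - 2\<close> to start from. The correction terms of
  index 0 to 3 are \<open>0\<close>, \<open>t\<close>, \<open>2 t * 2\<close> and \<open>3 t * 4 (1 + t)\<close>.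
\<close>

lemma D_rhs_scaled_eulerian_A_1:
  assumes t: "pderiv t = 1"
  shows "3 * t * (2 * ((1 + t) * 2)) = D_rhs t 1 (2 * t * 2) t 0"
  unfolding D_rhs_def pderiv_rules pderiv_0 t by algebra

theorem theorem5p3:
  fixes n :: nat
  assumes "n \<ge> 1"
  shows "eulerian_D (n + 2) =
      (of_nat n * (1 + 5 * \<t>) + 4 * \<t>) * eulerian_D (n + 1)
    + 4 * \<t> * (1 - \<t>) * pderiv (eulerian_D (n + 1))
    + ((1 - \<t>)^2 - of_nat n * (1 + 3 * \<t>)^2
        - 4 * of_nat n * (of_nat n - 1) * \<t> * (1 + 2 * \<t>)) * eulerian_D n
    - (4 * of_nat n * \<t> * (1 - \<t>) * (1 + 3 * \<t>) + 4 * \<t> * (1 - \<t>)^2)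
        * pderiv (eulerian_D n)
    - 4 * \<t>^2 * (1 - \<t>)^2 * pderiv (pderiv (eulerian_D n))
    + (2 * of_nat n * (of_nat n - 1) * \<t> * (3 + 2 * \<t> + 3 * \<t>^2)
        + 4 * of_nat n * (of_nat n - 1) * (of_nat n - 2) * \<t>^2 * (1 + \<t>))
        * eulerian_D (n - 1)
    + (2 * of_nat n * \<t> * (1 - \<t>)^2 * (3 + \<t>)
        + 8 * of_nat n * (of_nat n - 1) * \<t>^2 * (1 - \<t>) * (1 + \<t>))
        * pderiv (eulerian_D (n - 1))
    + 4 * of_nat n * \<t>^2 * (1 - \<t>)^2 * (1 + \<t>) * pderiv (pderiv (eulerian_D (n - 1)))"
proof -
  define N :: "int poly" where "N = of_nat n"
  have t: "pderiv \<t> = 1" by (simp add: pderiv_pCons)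
  have N: "pderiv N = 0" by (simp add: N_def)
  have B: "eulerian_B (n + 2) = D_rhs \<t> N (eulerian_B (n + 1)) (eulerian_B n) (eulerian_B (n - 1))"
  proof (rule D_rhs_eulerian_B[OF t N])
    from assms obtain m where n: "n = Suc m" by (cases n) auto
    show "eulerian_B n = (1 + (2 * N - 1) * \<t>) * eulerian_B (n - 1)
        + 2 * \<t> * (1 - \<t>) * pderiv (eulerian_B (n - 1))"
      unfolding N_def n diff_Suc_1 eulerian_B.simps of_nat_Suc by algebra
    show "eulerian_B (n + 1) = (1 + (2 * N + 1) * \<t>) * eulerian_B n
        + 2 * \<t> * (1 - \<t>) * pderiv (eulerian_B n)"
      unfolding N_def by (simp only: Suc_eq_plus1[symmetric] eulerian_B.simps)
    have "eulerian_B (n + 2) = eulerian_B (Suc (n + 1))" by simp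
    then show "eulerian_B (n + 2) = (1 + (2 * N + 3) * \<t>) * eulerian_B (n + 1)
        + 2 * \<t> * (1 - \<t>) * pderiv (eulerian_B (n + 1))"
      unfolding N_def eulerian_B.simps of_nat_add of_nat_1 by algebra
  qed
  have A: "(N + 2) * \<t> * scaled_eulerian_A (n + 1) =
    D_rhs \<t> N ((N + 1) * \<t> * scaled_eulerian_A n) (N * \<t> * scaled_eulerian_A (n - 1))
      ((N - 1) * \<t> * scaled_eulerian_A (n - 2))"
  proof (cases "n = 1")
    case True
    have "scaled_eulerian_A 0 = 1" "scaled_eulerian_A 1 = 2" "scaled_eulerian_A (1 + 1) = 2 * ((1 + \<t>) * 2)"
      by (simp_all add: pderiv_numeral)
    with D_rhs_scaled_eulerian_A_1[OF t] True show ?thesis by (simp add: N_def del: scaled_eulerian_A.simps)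
  next
    case False
    with assms have "n = Suc (Suc (n - 2))" by simp
    then obtain m where n: "n = Suc (Suc m)" by blast
    show ?thesis
    proof (rule D_rhs_scaled_eulerian_A[OF t N])
      show "scaled_eulerian_A (n - 1) = 2 * ((1 + (N - 2) * \<t>) * scaled_eulerian_A (n - 2)
          + \<t> * (1 - \<t>) * pderiv (scaled_eulerian_A (n - 2)))"
        by (simp add: N_def n del: mult_pCons_left mult_pCons_right)
      show "scaled_eulerian_A n = 2 * ((1 + (N - 1) * \<t>) * scaled_eulerian_A (n - 1)
          + \<t> * (1 - \<t>) * pderiv (scaled_eulerian_A (n - 1)))"
        by (simp only: N_def n diff_Suc_1 scaled_eulerian_A.simps(2)[of "Suc m"] of_nat_Suc add_diff_cancel_left')
      show "scaled_eulerian_A (n + 1) = 2 * ((1 + N * \<t>) * scaled_eulerian_A n + \<t> * (1 - \<t>) * pderiv (scaled_eulerian_A n))"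
        unfolding N_def by (simp only: Suc_eq_plus1[symmetric] scaled_eulerian_A.simps)
    qed
  qed
  have D: "eulerian_D (n + 2) = eulerian_B (n + 2) - (N + 2) * \<t> * scaled_eulerian_A (n + 1)"
    "eulerian_D (n + 1) = eulerian_B (n + 1) - (N + 1) * \<t> * scaled_eulerian_A n"
    "eulerian_D n = eulerian_B n - N * \<t> * scaled_eulerian_A (n - 1)"
    "eulerian_D (n - 1) = eulerian_B (n - 1) - (N - 1) * \<t> * scaled_eulerian_A (n - 2)"
    unfolding eulerian_D_eq N_def using assms
    by (simp_all add: of_nat_diff numeral_2_eq_2 del: mult_pCons_left mult_pCons_right
        scaled_eulerian_A.simps eulerian_B.simps)
  have "eulerian_D (n + 2) =
      D_rhs \<t> N (eulerian_D (n + 1)) (eulerian_D n) (eulerian_D (n - 1))"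
    unfolding D D_rhs_diff A B ..
  then show ?thesis
    unfolding D_rhs_def N_def .
qed

end
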